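(* For every cactus graph $G\in\mathcal{C}_{n,k}$ it holds that $\mathrm{gpn}(G)\geq\binom{n+1}{2}$, with equality if and only if each cycle in $G$ is of odd length.
   Context: All graphs are finite, simple and connected. For distinct $u,v\in V(G)$, $\mathrm{gpn}_G(u,v)$ denotes the number of shortest $u$–$v$ paths in $G$, and for a graph $G$ on $n$ vertices $\mathrm{gpn}(G)=\sum_{\{u,v\}\subseteq V(G),\,u\neq v}\mathrm{gpn}_G(u,v)+n$ (sum over unordered pairs of distinct vertices). A cactus graph is a (connected, simple) graph in which all cycles are pairwise edge disjoint. $\mathcal{C}_{n,k}$ is the class of all cactus graphs on $n$ vertices with exactly $k$ cycles. *)

theory Defs
  imports "Graph_Theory.Graph_Theory"
begin

text \<open>
  Finite simple graphs are rendered by the locale \<open>pair_graph\<close>: an edge \<open>ab\<close> is the pair of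
  opposite arcs \<open>(a,b)\<close>, \<open>(b,a)\<close>, so a path or cycle of the graph traversed from a given start in
  a given direction is exactly one arc list.
\<close>

definition shortest_path :: "'a pair_pre_digraph \<Rightarrow> 'a \<Rightarrow> ('a \<times> 'a) awalk \<Rightarrow> 'a \<Rightarrow> bool" where
  "shortest_path G u p v \<longleftrightarrow>
     pre_digraph.apath (with_proj G) u p v \<and>
     (\<forall>q. pre_digraph.apath (with_proj G) u q v \<longrightarrow> length p \<le> length q)"

definition gpn_between :: "'a pair_pre_digraph \<Rightarrow> 'a \<Rightarrow> 'a \<Rightarrow> nat" where
  "gpn_between G u v = card {p. shortest_path G u p v}"

lemma gpn_between_commute:
  assumes "pair_graph G"
  shows "gpn_between G u v = gpn_between G v u"
proof -
  interpret pair_graph G by fact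
  have len: "length (rev_path p) = length p" for p :: "('a \<times> 'a) awalk"
    by (induction p) auto
  have rev: "shortest_path G y (rev_path p) x" if "shortest_path G x p y" for x y p
    using that unfolding shortest_path_def
    by (metis apath_rev_path len)
  have "bij_betw rev_path {p. shortest_path G u p v} {p. shortest_path G v p u}"
    by (rule bij_betw_byWitness[where f' = rev_path]) (auto intro: rev)
  then show ?thesis
    unfolding gpn_between_def by (rule bij_betw_same_card)
qed

text \<open>
  The sum ranges over unordered pairs \<open>P = {u, v}\<close> of distinct vertices.  The description below
  is well defined since \<open>gpn_between\<close> is symmetric, see \<open>gpn_summand\<close>.
\<close>

definition gpn :: "'a pair_pre_digraph \<Rightarrow> nat" where
  "gpn G = (\<Sum>P | P \<subseteq> pverts G \<and> card P = 2.
              (THE m. \<exists>u v. P = {u, v} \<and> m = gpn_between G u v)) + card (pverts G)"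

lemma gpn_summand:
  assumes "pair_graph G"
  shows "(THE m. \<exists>x y. {u, v} = {x, y} \<and> m = gpn_between G x y) = gpn_between G u v"
  by (rule the_equality) (auto simp: doubleton_eq_iff gpn_between_commute[OF assms])

text \<open>
  In a symmetric digraph the library's \<open>cycle\<close> also admits \<open>a, b, a\<close>, the two directions of a
  single edge; requiring length at least 3 leaves exactly the cycles of the undirected graph.
\<close>

definition is_cycle :: "'a pair_pre_digraph \<Rightarrow> ('a \<times> 'a) awalk \<Rightarrow> bool" where
  "is_cycle G p \<longleftrightarrow> pre_digraph.cycle (with_proj G) p \<and> 3 \<le> length p"

definition undirected_edges :: "('a \<times> 'a) awalk \<Rightarrow> 'a set set" where
  "undirected_edges p = (\<lambda>(a, b). {a, b}) ` set p"

text \<open>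
  A cycle as a subgraph, independent of starting vertex and orientation, is given by its edge set.
\<close>

definition cycles :: "'a pair_pre_digraph \<Rightarrow> 'a set set set" where
  "cycles G = {undirected_edges p | p. is_cycle G p}"

definition cactus :: "'a pair_pre_digraph \<Rightarrow> bool" where
  "cactus G \<longleftrightarrow> pair_graph G \<and> connected (with_proj G) \<and> pairwise disjnt (cycles G)"

definition cactus_class :: "nat \<Rightarrow> nat \<Rightarrow> 'a pair_pre_digraph set" where
  "cactus_class n k = {G. cactus G \<and> card (pverts G) = n \<and> card (cycles G) = k}"

end

theory Submission
  imports Defs
begin

text \<open>
  Every pair of distinct vertices contributes at least 1, so equality means that shortest paths are
  unique.  Two distinct shortest paths with common ends and minimal length are internally disjoint,
  hence form an even cycle.  Conversely, in a cactus distances between vertices of a cycle are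
  realised inside the cycle, so two antipodal vertices of an even cycle are joined by two shortest
  paths.
\<close>

section \<open>Shortest paths and even cycles\<close>

context pair_graph
begin

text \<open>Deleting closed subwalks from a walk leaves a path that is no longer. With unit arc
  costs no cycle is negative, so the cost bound for \<open>awalk_to_apath\<close> says exactly
  this.\<close>

lemma shortest_path_le_awalk:
  assumes "shortest_path G u p v" "awalk u q v"
  shows "length p \<le> length q"
proof -
  have cost: "awalk_cost (\<lambda>_. 1) r = real (length r)" for r :: "('a \<times> 'a) awalk"
    by (induction r) (auto simp: awalk_cost_def)
  have "awalk_cost (\<lambda>_. 1) (awalk_to_apath q) \<le> awalk_cost (\<lambda>_. 1) q"
    by (rule awalk_to_path_no_neg_cyc_cost[OF assms(2)]) (simp add: cost)
  then have "length (awalk_to_apath q) \<le> length q"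
    by (simp add: cost)
  moreover have "length p \<le> length (awalk_to_apath q)"
    using assms apath_awalk_to_apath unfolding shortest_path_def by blast
  ultimately show ?thesis
    by simp
qed

text \<open>Replacing one part by a rival path gives a walk that may repeat vertices, so the
  comparison with \<open>p @ q\<close> goes through \<open>shortest_path_le_awalk\<close>.\<close>

lemma shortest_path_appendD:
  assumes "shortest_path G u (p @ q) v" "awalk u p w" "awalk w q v"
  shows "shortest_path G u p w" "shortest_path G w q v"
proof -
  have ap: "apath u p w" "apath w q v"
    using assms unfolding shortest_path_def by (auto simp: apath_append_iff)
  have "length p \<le> length r" if "apath u r w" for r
  proof -
    have "awalk u (r @ q) v"
      using that assms(3) by (meson awalkI_apath awalk_appendI)
    from shortest_path_le_awalk[OF assms(1) this] show ?thesis by simp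
  qed
  with ap show "shortest_path G u p w"
    unfolding shortest_path_def by blast
  have "length q \<le> length r" if "apath w r v" for r
  proof -
    have "awalk u (p @ r) v"
      using that assms(2) by (meson awalkI_apath awalk_appendI)
    from shortest_path_le_awalk[OF assms(1) this] show ?thesis by simp
  qed
  with ap show "shortest_path G w q v"
    unfolding shortest_path_def by blast
qed

lemma apath_same_ends: "apath u p u \<longleftrightarrow> p = [] \<and> u \<in> pverts G"
  using apath_nonempty_ends apath_Nil_iff by (metis with_proj_simps(1))

text \<open>The tails of the two vertex lists keep one occurrence each of \<open>x\<close> and
  \<open>y\<close>, so their concatenation is free of repetitions. The two-arc closed walk
  \<open>a, b, a\<close> is still covered; callers check the length themselves.\<close>

lemma cycle_append:
  assumes "apath x p y" "apath y q x" "x \<noteq> y"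
    and disj: "set (awalk_verts x p) \<inter> set (awalk_verts y q) \<subseteq> {x, y}"
  shows "cycle (p @ q)"
proof -
  have aw: "awalk x (p @ q) x"
    using assms by (meson awalkI_apath awalk_appendI)
  have "p \<noteq> []"
    using assms apath_Nil_iff by auto
  have 1: "awalk_verts x (p @ q) = awalk_verts x p @ tl (awalk_verts y q)"
    using awalk_verts_append[OF aw] assms(1) by (auto simp: apath_def)
  obtain ps qs where ps: "awalk_verts x p = x # ps" and qs: "awalk_verts y q = y # qs"
    using assms(1,2) by (metis apath_def awhd_of_awalk awalk_verts_non_Nil list.collapse)
  have "distinct (x # ps)" "distinct (y # qs)"
    using assms(1,2) ps qs by (auto simp: apath_def)
  with disj have "distinct (ps @ qs)"
    unfolding ps qs by auto
  then show ?thesis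
    unfolding cycle_def using aw 1 ps qs \<open>p \<noteq> []\<close> by (intro exI[of _ x]) (simp del: awalk_append_iff)
qed

lemma length_rev_path [simp]: "length (rev_path p) = length p"
  by (induction p) auto

lemma undirected_edges_rev_path [simp]:
  "undirected_edges (rev_path p) = undirected_edges p"
  by (induction p) (auto simp: undirected_edges_def doubleton_eq_iff)

text \<open>Strong induction on the common length. Either the paths share only their ends, and
  \<open>p\<close> followed by the reversal of \<open>q\<close> is a cycle of length twice
  \<open>length p\<close>, or they meet at an inner vertex, where both split into shortest
  paths.\<close>

lemma even_cycle_if_two_shortest_paths:
  assumes "shortest_path G u p v" "shortest_path G u q v" "p \<noteq> q"
  shows "\<exists>c. is_cycle G c \<and> even (length c)"
  using assms
proof (induction "length p" arbitrary: u p q v rule: less_induct)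
  case less
  have ap: "apath u p v" "apath u q v"
    using less.prems by (auto simp: shortest_path_def)
  have len: "length p = length q"
    using less.prems by (meson le_antisym shortest_path_def)
  have "u \<noteq> v"
    using ap less.prems(3) by (auto simp: apath_same_ends)
  show ?case
  proof (cases "set (awalk_verts u p) \<inter> set (awalk_verts u q) \<subseteq> {u, v}")
    case True
    have "cycle (p @ rev_path q)"
      using ap True \<open>u \<noteq> v\<close> by (intro cycle_append) (auto simp: awalk_verts_rev_path apath_def)
    \<comment> \<open>A single arc is determined by its ends, so different shortest paths have at
      least two arcs each.\<close>
    moreover have "2 \<le> length p"
    proof (rule ccontr)
      assume "\<not> ?thesis"
      then have "length p = 0 \<or> length p = 1" unfolding not_le by linarith
      then show False
      proof
        assume "length p = 1"
        then obtain a b where "p = [a]" "q = [b]"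
          using len by (auto simp: length_Suc_conv)
        then show False
          using ap less.prems(3) by (cases a; cases b) (auto simp: apath_simps)
      qed (use len less.prems(3) in auto)
    qed
    ultimately have "is_cycle G (p @ rev_path q)" "even (length (p @ rev_path q))"
      using len by (auto simp: is_cycle_def)
    then show ?thesis by blast
  next
    case False
    then obtain w where w: "w \<in> set (awalk_verts u p)" "w \<in> set (awalk_verts u q)" "w \<noteq> u" "w \<noteq> v"
      by auto
    obtain p1 p2 where p: "p = p1 @ p2" "awalk u p1 w" "awalk w p2 v"
      using awalk_decomp w ap by (metis awalkI_apath)
    obtain q1 q2 where q: "q = q1 @ q2" "awalk u q1 w" "awalk w q2 v"
      using awalk_decomp w ap by (metis awalkI_apath)
    have "p1 \<noteq> []" "p2 \<noteq> []"
      using p w by (auto simp: awalk_Nil_iff)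
    then have "length p1 < length p" "length p2 < length p"
      using p by auto
    \<comment> \<open>One of the two pairs of parts must differ, and the induction hypothesis
      applies to that pair.\<close>
    moreover have "p1 \<noteq> q1 \<or> p2 \<noteq> q2"
      using less.prems p q by auto
    ultimately show ?thesis
      using less.hyps shortest_path_appendD less.prems(1,2) p q by metis
  qed
qed

section \<open>Segments of walks and cycles by vertex index\<close>

lemma awalk_segment:
  assumes "awalk u p v" "i \<le> j" "j \<le> length p"
  defines "vs \<equiv> awalk_verts u p"
  shows "awalk (vs ! i) (drop i (take j p)) (vs ! j)"
    and "awalk_verts (vs ! i) (drop i (take j p)) = drop i (take (Suc j) vs)"
proof -
  have lvs: "length vs = Suc (length p)"
    by (simp add: vs_def length_awalk_verts)
  have last: "awlast u (take n p) = vs ! n" if "n \<le> length p" for n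
    using that assms(1) lvs unfolding vs_def
    by (auto simp: awalk_verts_take_conv last_conv_nth)
  have 1: "awalk u (take j p) (vs ! j)"
    using assms(1,3) last[of j] awalk_append_iff[of u "take j p" "drop j p" v] by auto
  then have "awalk u (take i (take j p) @ drop i (take j p)) (vs ! j)"
    by (simp only: append_take_drop_id)
  then have "awalk (awlast u (take i (take j p))) (drop i (take j p)) (vs ! j)"
    by (simp del: take_take append_take_drop_id)
  then show seg: "awalk (vs ! i) (drop i (take j p)) (vs ! j)"
    using last[of i] assms(2,3) by (simp add: min_def)
  show "awalk_verts (vs ! i) (drop i (take j p)) = drop i (take (Suc j) vs)"
  proof (cases "i < j")
    case True
    have "cas u (take j p) (vs ! j)" "cas u p v" using 1 assms(1) by auto
    then show ?thesis
      using True assms(3) by (simp add: awalk_verts_drop_conv awalk_verts_take_conv vs_def)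
  next
    case False
    then have "i = j" using assms(2) by simp
    then show ?thesis
      using assms(3) lvs by (simp add: take_Suc_conv_app_nth)
  qed
qed

end

text \<open>The conditions of \<open>is_cycle\<close> with the base vertex \<open>u\<close> as a
  parameter. Vertices then carry indices 0 to \<open>m\<close>, where both 0 and \<open>m\<close>
  stand for \<open>u\<close>.\<close>

locale indexed_cycle = pair_graph +
  fixes u c
  assumes closed: "awalk u c u"
    and distinct_tl: "distinct (tl (awalk_verts u c))"
    and length_ge_3: "3 \<le> length c"
begin

definition "vs \<equiv> awalk_verts u c"
definition "m \<equiv> length c"

lemma length_vs: "length vs = Suc m"
  by (simp add: vs_def m_def length_awalk_verts)

lemma m_ge_3: "3 \<le> m"
  using length_ge_3 by (simp add: m_def)

lemma vs_0: "vs ! 0 = u" and vs_m: "vs ! m = u"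
  using closed length_vs unfolding vs_def
  by (metis awhd_of_awalk awalk_verts_non_Nil hd_conv_nth,
      metis awlast_if_cas awalkE' awalk_verts_non_Nil diff_Suc_1 last_conv_nth)

lemma vs_inj:
  assumes "vs ! i = vs ! j" "i < m" "j < m"
  shows "i = j"
proof -
  have *: False if "vs ! a = vs ! b" "a < b" "b \<le> m" "0 < a \<or> b < m" for a b
  proof -
    \<comment> \<open>Distinctness is known only for the tail, which lacks index 0; that index is
      traded for \<open>m\<close>, the other occurrence of \<open>u\<close>.\<close>
    define a' where "a' = (if a = 0 then m else a)"
    have "vs ! a' = vs ! b" "a' \<noteq> b" "0 < a'" "a' \<le> m"
      using that m_ge_3 vs_0 vs_m by (auto simp: a'_def)
    moreover have "vs ! n = tl vs ! (n - 1)" if "0 < n" "n \<le> m" for n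
      using that length_vs by (simp add: nth_tl)
    ultimately have "tl vs ! (a' - 1) = tl vs ! (b - 1)" "a' - 1 \<noteq> b - 1" "a' - 1 < length (tl vs)"
       "b - 1 < length (tl vs)"
      using that length_vs by auto
    then show False
      using distinct_tl nth_eq_iff_index_eq unfolding vs_def by blast
  qed
  show ?thesis
    using *[of i j] *[of j i] assms by (metis less_imp_le_nat nat_neq_iff)
qed

lemma is_cycle: "is_cycle G c"
  using closed distinct_tl length_ge_3 unfolding is_cycle_def cycle_def by force

lemma in_vs_iff: "x \<in> set vs \<longleftrightarrow> (\<exists>i<m. x = vs ! i)"
  using length_vs m_ge_3 vs_0 vs_m
  by (auto simp: in_set_conv_nth less_Suc_eq) (metis gr0I not_numeral_le_zero)

lemma nth_c: "l < m \<Longrightarrow> c ! l = (vs ! l, vs ! Suc l)"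
proof -
  assume l: "l < m"
  have "c \<noteq> []" using length_ge_3 by auto
  have "vs ! l = fst (c ! l)"
    using l unfolding vs_def m_def by (simp add: awalk_verts_conv \<open>c \<noteq> []\<close> nth_append)
  moreover have "vs ! Suc l = snd (c ! l)"
    using l closed unfolding vs_def m_def
    by (subst awalk_verts_conv'[of u c u]) (auto simp: \<open>c \<noteq> []\<close>)
  ultimately show ?thesis
    by simp
qed

lemma undirected_edges_c: "undirected_edges c = {{vs ! l, vs ! Suc l} | l. l < m}"
proof -
  have "set c = {(vs ! l, vs ! Suc l) | l. l < m}"
    using nth_c unfolding set_conv_nth by (auto simp: m_def) metis
  then show ?thesis
    unfolding undirected_edges_def by auto
qed

text \<open>The last hypothesis excludes just the full turn from 0 to \<open>m\<close>, which is
  closed. If \<open>0 < i\<close>, the segment lies in the distinct tail; otherwise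
  \<open>j < m\<close> and \<open>vs_inj\<close> applies.\<close>

lemma apath_segment:
  assumes "i \<le> j" "j \<le> m" "0 < i \<or> j < m"
  shows "apath (vs ! i) (drop i (take j c)) (vs ! j)"
    and "awalk_verts (vs ! i) (drop i (take j c)) = drop i (take (Suc j) vs)"
proof -
  have *: "awalk_verts (vs ! i) (drop i (take j c)) = drop i (take (Suc j) vs)"
    and aw: "awalk (vs ! i) (drop i (take j c)) (vs ! j)"
    using awalk_segment[OF closed] assms by (auto simp: vs_def m_def)
  show "awalk_verts (vs ! i) (drop i (take j c)) = drop i (take (Suc j) vs)" by fact
  have "distinct (drop i (take (Suc j) vs))"
  proof (cases "0 < i")
    case True
    then obtain i' where "i = Suc i'" using gr0_implies_Suc by blast
    then have "drop i (take (Suc j) vs) = drop i' (take j (tl vs))"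
      by (cases vs) auto
    then show ?thesis
      using distinct_tl by (simp add: vs_def)
  next
    case False
    then have "j < m" using assms by simp
    then have "distinct (take (Suc j) vs)"
      unfolding distinct_conv_nth using vs_inj length_vs by auto
    then show ?thesis by simp
  qed
  with * aw show "apath (vs ! i) (drop i (take j c)) (vs ! j)"
    by (simp add: apath_def)
qed

text \<open>Serves to close a path that leaves the cycle. The segment between the smaller and the
  larger index is taken, reversed when \<open>i < j\<close>.\<close>

lemma arc_between:
  assumes "i < m" "j < m" "i \<noteq> j"
  obtains b where "apath (vs ! j) b (vs ! i)" "set (awalk_verts (vs ! j) b) \<subseteq> set vs"
    "undirected_edges b \<subseteq> undirected_edges c"
proof (cases "i < j")
  case True
  let ?s = "drop i (take j c)"
  have s: "apath (vs ! i) ?s (vs ! j)" "set (awalk_verts (vs ! i) ?s) \<subseteq> set vs"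
    using apath_segment[of i j] True assms by (auto dest: in_set_dropD in_set_takeD)
  show thesis
  proof (rule that[of "rev_path ?s"])
    show "undirected_edges (rev_path ?s) \<subseteq> undirected_edges c"
      unfolding undirected_edges_rev_path unfolding undirected_edges_def
      by (intro image_mono subsetI) (auto dest: in_set_dropD in_set_takeD)
    show "set (awalk_verts (vs ! j) (rev_path ?s)) \<subseteq> set vs"
      using s awalk_verts_rev_path[OF awalkI_apath[OF s(1)]] by simp
  qed (use s in auto)
next
  case False
  then have "j < i" using assms by simp
  let ?s = "drop j (take i c)"
  have s: "apath (vs ! j) ?s (vs ! i)" "set (awalk_verts (vs ! j) ?s) \<subseteq> set vs"
    using apath_segment[of j i] \<open>j < i\<close> assms by (auto dest: in_set_dropD in_set_takeD)
  moreover have "undirected_edges ?s \<subseteq> undirected_edges c"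
    unfolding undirected_edges_def
    by (intro image_mono subsetI) (auto dest: in_set_dropD in_set_takeD)
  ultimately show thesis
    using that by blast
qed

section \<open>Distances along a cycle of a cactus\<close>

text \<open>
  The number \<open>min i (m - i)\<close> is the distance from \<open>vs ! 0\<close> to \<open>vs ! i\<close> inside the cycle.  It is
  1-Lipschitz along every path of \<open>G\<close>: a path that leaves the cycle between two of its vertices
  would close up, with a segment of the cycle, to a second cycle sharing an edge with the first.
\<close>

lemma cycle_dist_le_length:
  assumes disj: "pairwise disjnt (cycles G)"
    and "i < m" "j < m" "apath (vs ! i) q (vs ! j)"
  shows "min j (m - j) \<le> min i (m - i) + length q"
  using assms(2-)
proof (induction "length q" arbitrary: i j q rule: less_induct)
  case less
  note ap = \<open>apath (vs ! i) q (vs ! j)\<close>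
  show ?case
  proof (cases "i = j")
    case False
    then have ne: "vs ! i \<noteq> vs ! j"
      using vs_inj less.prems by blast
    show ?thesis
    proof (cases "set (awalk_verts (vs ! i) q) \<inter> set vs \<subseteq> {vs ! i, vs ! j}")
      case True
      obtain b where b: "apath (vs ! j) b (vs ! i)" "set (awalk_verts (vs ! j) b) \<subseteq> set vs"
          "undirected_edges b \<subseteq> undirected_edges c"
        using arc_between less.prems False by metis
      have qb_ne: "q \<noteq> []" "b \<noteq> []"
        using ap b ne by (auto simp: apath_Nil_iff)
      have cyc: "cycle (q @ b)"
        using cycle_append[OF ap b(1) ne] b(2) True by blast
      have sub: "undirected_edges q \<subseteq> undirected_edges c"
      proof (cases "3 \<le> length (q @ b)")
        case True
        then have "is_cycle G (q @ b)"
          using cyc by (simp add: is_cycle_def)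
        then have "undirected_edges (q @ b) \<in> cycles G" "undirected_edges c \<in> cycles G"
          using is_cycle unfolding cycles_def by auto
        \<comment> \<open>Since \<open>b\<close> is nonempty and its edges lie on \<open>c\<close>,
          the two cycles share an edge and must have the same edge set.\<close>
        moreover have "\<not> disjnt (undirected_edges (q @ b)) (undirected_edges c)"
          using b(3) qb_ne(2) by (cases b) (auto simp: undirected_edges_def disjnt_def)
        ultimately have "undirected_edges (q @ b) = undirected_edges c"
          using disj unfolding pairwise_def by blast
        then show ?thesis
          by (auto simp: undirected_edges_def)
      next
        case False
        \<comment> \<open>Here \<open>q\<close> and \<open>b\<close> are opposite arcs of one
          edge.\<close>
        moreover have "length q \<noteq> 0" "length b \<noteq> 0"
          using qb_ne by simp_all
        ultimately have "length q = 1" "length b = 1"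
          unfolding length_append by linarith+
        then obtain x y where "q = [x]" "b = [y]"
          by (auto simp: length_Suc_conv)
        then have "undirected_edges q = undirected_edges b"
          using ap b(1) by (cases x; cases y) (auto simp: apath_simps undirected_edges_def)
        then show ?thesis using b by simp
      qed
      \<comment> \<open>The first arc of \<open>q\<close> is an edge of the cycle, so its head is
        already \<open>vs ! j\<close>. The two indices are cyclically adjacent, and their cycle
        distances differ by at most 1.\<close>
      obtain x w q' where q: "q = (x, w) # q'"
        using qb_ne by (cases q) auto
      have x: "x = vs ! i" "w \<noteq> vs ! i" "w \<in> set (awalk_verts (vs ! i) q)"
        using ap by (auto simp: q apath_Cons_iff hd_in_awalk_verts)
      have "{x, w} \<in> undirected_edges c"
        using sub by (auto simp: q undirected_edges_def)
      then obtain l where l: "l < m" "{x, w} = {vs ! l, vs ! Suc l}"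
        by (auto simp: undirected_edges_c)
      have "w \<in> set vs"
        using l length_vs by (auto simp: doubleton_eq_iff)
      with x True have "w = vs ! j" by blast
      have "(i = l \<and> vs ! j = vs ! Suc l) \<or> (j = l \<and> vs ! i = vs ! Suc l)"
        using l x \<open>w = vs ! j\<close> less.prems by (metis doubleton_eq_iff vs_inj)
      \<comment> \<open>Index \<open>m\<close> wraps around to 0.\<close>
      moreover have "n = (if Suc l = m then 0 else Suc l)" if "vs ! n = vs ! Suc l" "n < m" for n
        using that l vs_0 vs_m vs_inj m_ge_3 by (auto split: if_splits)
      ultimately have "i = l \<and> j = (if Suc l = m then 0 else Suc l) \<or>
          j = l \<and> i = (if Suc l = m then 0 else Suc l)"
        using less.prems by blast
      then have "min j (m - j) \<le> min i (m - i) + 1"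
        using l m_ge_3 by (auto split: if_splits)
      then show ?thesis
        by (simp add: q)
    next
      case False
      then obtain w where w: "w \<in> set (awalk_verts (vs ! i) q)" "w \<in> set vs"
          "w \<noteq> vs ! i" "w \<noteq> vs ! j"
        by blast
      then obtain l where l: "vs ! l \<in> set (awalk_verts (vs ! i) q)" "l < m"
          "vs ! l \<noteq> vs ! i" "vs ! l \<noteq> vs ! j"
        using in_vs_iff[of w] by blast
      \<comment> \<open>Both parts are shorter than \<open>q\<close>, and the two bounds from the
        induction add up.\<close>
      obtain q1 q2 where q: "q = q1 @ q2" "awalk (vs ! i) q1 (vs ! l)" "awalk (vs ! l) q2 (vs ! j)"
        using awalk_decomp l ap by (metis awalkI_apath)
      have "q1 \<noteq> []" "q2 \<noteq> []"
        using q l by (auto simp: awalk_Nil_iff)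
      moreover have "apath (vs ! i) q1 (vs ! l)" "apath (vs ! l) q2 (vs ! j)"
        using ap q by (auto simp: apath_append_iff)
      ultimately have "min l (m - l) \<le> min i (m - i) + length q1"
        "min j (m - j) \<le> min l (m - l) + length q2"
        using less.hyps[of q1 i l] less.hyps[of q2 l j] less.prems l q by auto
      then show ?thesis
        by (simp add: q)
    qed
  qed simp
qed

text \<open>For \<open>m = 2 * k\<close> the two halves of the cycle from \<open>u\<close> to
  \<open>vs ! k\<close> have length \<open>k\<close>, and \<open>cycle_dist_le_length\<close> from
  index 0 shows that no path is shorter.\<close>

lemma two_shortest_paths_if_even:
  assumes "pairwise disjnt (cycles G)" "even (length c)"
  obtains v p q where "shortest_path G u p v" "shortest_path G u q v" "u \<noteq> v" "p \<noteq> q"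
proof -
  define k where "k = m div 2"
  have k: "m = 2 * k" "2 \<le> k"
    using assms(2) m_ge_3 by (auto simp: k_def m_def)
  let ?p = "take k c" and ?q = "rev_path (drop k c)"
  have p: "apath u ?p (vs ! k)" "awalk_verts u ?p = take (Suc k) vs"
    using apath_segment[of 0 k] k by (auto simp: vs_0)
  have q': "apath (vs ! k) (drop k c) u" "awalk_verts (vs ! k) (drop k c) = drop k vs"
    using apath_segment[of k m] k length_vs vs_m by (auto simp: m_def)
  then have q: "apath u ?q (vs ! k)" "awalk_verts u ?q = rev (drop k vs)"
    by (auto simp: awalk_verts_rev_path apath_def)
  have min: "k \<le> length r" if "apath u r (vs ! k)" for r
    using cycle_dist_le_length[OF assms(1), of 0 k r] that k by (simp add: vs_0)
  have "?p \<noteq> ?q"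
  proof
    assume "?p = ?q"
    then have "take (Suc k) vs = rev (drop k vs)"
      using p q by simp
    \<comment> \<open>The second vertices of the halves are \<open>vs ! 1\<close> and
      \<open>vs ! (m - 1)\<close>, distinct because \<open>m\<close> is at least 4.\<close>
    moreover have "take (Suc k) vs ! 1 = vs ! 1"
      using k by simp
    moreover have "rev (drop k vs) ! 1 = vs ! (m - 1)"
      using k length_vs by (simp add: rev_nth mult_2)
    ultimately show False
      using vs_inj[of 1 "m - 1"] k by simp
  qed
  moreover have "u \<noteq> vs ! k"
    using vs_inj[of 0 k] k vs_0 by auto
  moreover have "shortest_path G u ?p (vs ! k)" "shortest_path G u ?q (vs ! k)"
    using p q min k unfolding shortest_path_def by (auto simp: m_def)
  ultimately show thesis
    using that by blast
qed

end

section \<open>Counting shortest paths, and the bound\<close>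

context pair_graph
begin

text \<open>Needed because \<open>card\<close> is 0 on infinite sets, so that
  \<open>gpn_between\<close> would not count.\<close>

lemma finite_shortest_paths: "finite {p. shortest_path G u p v}"
  by (rule finite_subset[OF _ apaths_finite[of u v]]) (auto simp: shortest_path_def)

lemma shortest_path_exists:
  assumes "connected (with_proj G)" "u \<in> pverts G" "v \<in> pverts G"
  obtains p where "shortest_path G u p v"
proof -
  have "strongly_connected (with_proj G)"
    using assms(1) symmetric_connected_imp_strongly_connected sym_arcs by blast
  then obtain r where "apath u r v"
    using assms(2,3) reachable_apath unfolding strongly_connected_def by (metis with_proj_simps(1))
  then show thesis
    using that ex_has_least_nat[of "\<lambda>p. apath u p v" r length] unfolding shortest_path_def by blast
qed

lemma gpn_between_ge_1:
  assumes "connected (with_proj G)" "u \<in> pverts G" "v \<in> pverts G"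
  shows "1 \<le> gpn_between G u v"
proof -
  have "{p. shortest_path G u p v} \<noteq> {}"
    using shortest_path_exists[OF assms] by blast
  then show ?thesis
    unfolding gpn_between_def using finite_shortest_paths[of u v]
    by (simp add: Suc_le_eq card_gt_0_iff)
qed

lemma gpn_between_le_1_iff:
  "gpn_between G u v \<le> 1 \<longleftrightarrow> (\<forall>p q. shortest_path G u p v \<longrightarrow> shortest_path G u q v \<longrightarrow> p = q)"
  unfolding gpn_between_def using finite_shortest_paths[of u v]
  by (auto simp: card_le_Suc0_iff_eq)

text \<open>The equality case, pair by pair. The cactus property enters where an even cycle has to
  produce two shortest paths.\<close>

lemma all_gpn_between_le_1_iff:
  assumes "pairwise disjnt (cycles G)"
  shows "(\<forall>u v. u \<noteq> v \<longrightarrow> gpn_between G u v \<le> 1) \<longleftrightarrow> (\<forall>p. is_cycle G p \<longrightarrow> odd (length p))"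
proof
  assume unique: "\<forall>u v. u \<noteq> v \<longrightarrow> gpn_between G u v \<le> 1"
  show "\<forall>p. is_cycle G p \<longrightarrow> odd (length p)"
  proof (intro allI impI)
    fix c assume "is_cycle G c"
    then obtain u where "awalk u c u" "distinct (tl (awalk_verts u c))" "3 \<le> length c"
      unfolding is_cycle_def cycle_def by auto
    then interpret indexed_cycle G u c
      by unfold_locales
    show "odd (length c)"
      using two_shortest_paths_if_even[OF assms] unique unfolding gpn_between_le_1_iff by metis
  qed
next
  assume "\<forall>p. is_cycle G p \<longrightarrow> odd (length p)"
  then show "\<forall>u v. u \<noteq> v \<longrightarrow> gpn_between G u v \<le> 1"
    unfolding gpn_between_le_1_iff using even_cycle_if_two_shortest_paths by blast
qed

text \<open>Lets uniqueness be stated for all \<open>u\<close> and \<open>v\<close> of the type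
  instead of vertices only.\<close>

lemma gpn_between_eq_0:
  assumes "u \<notin> pverts G \<or> v \<notin> pverts G"
  shows "gpn_between G u v = 0"
proof -
  have "\<not> apath u p v" for p
    using assms by (auto simp: apath_def)
  then show ?thesis
    by (simp add: gpn_between_def shortest_path_def)
qed

end

text \<open>Pascal's rule; the summand \<open>n\<close> of \<open>gpn\<close> turns the number of
  pairs into the claimed bound.\<close>

lemma choose_2_add_self: "(n choose 2) + n = (n + 1) choose 2"
  by (simp add: numeral_2_eq_2)

theorem mainTheorem7:
  fixes G :: "'a pair_pre_digraph" and n k :: nat
  assumes "G \<in> cactus_class n k"
  shows "gpn G \<ge> (n + 1) choose 2 \<and>
         (gpn G = (n + 1) choose 2 \<longleftrightarrow> (\<forall>p. is_cycle G p \<longrightarrow> odd (length p)))"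
proof -
  have pg: "pair_graph G" and conn: "connected (with_proj G)"
    and disj: "pairwise disjnt (cycles G)" and n: "card (pverts G) = n"
    using assms by (auto simp: cactus_class_def cactus_def)
  interpret pair_graph G by (fact pg)
  define \<P> where "\<P> = {P. P \<subseteq> pverts G \<and> card P = 2}"
  define g where "g P = (THE m. \<exists>u v. P = {u, v} \<and> m = gpn_between G u v)" for P
  have g: "g {u, v} = gpn_between G u v" for u v
    unfolding g_def by (rule gpn_summand[OF pg])
  have fin: "finite \<P>" and card: "card \<P> = n choose 2"
    using n_subsets[of "pverts G" 2] n by (auto simp: \<P>_def)
  have g_ge: "1 \<le> g P" if "P \<in> \<P>" for P
    using that gpn_between_ge_1[OF conn] g by (auto simp: \<P>_def card_2_iff)
  have gpn: "gpn G = sum g \<P> + n"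
    unfolding gpn_def g_def \<P>_def n ..
  have ge: "sum g \<P> \<ge> n choose 2"
    using sum_mono[of \<P> "\<lambda>_. 1" g] g_ge card by simp
  have "sum g \<P> = n choose 2 \<longleftrightarrow> (\<forall>P\<in>\<P>. g P \<le> 1)"
  proof -
    \<comment> \<open>Each \<open>g P\<close> is at least 1, so the subtraction of naturals is
      exact: the surplus over \<open>n choose 2\<close> is the sum of the terms
      \<open>g P - 1\<close>, which is 0 only if all of them are.\<close>
    have "sum g \<P> = n choose 2 \<longleftrightarrow> (\<Sum>P\<in>\<P>. g P - 1) = 0"
      using sum_subtractf_nat[of \<P> "\<lambda>_. 1" g] g_ge ge card
      by (metis card_eq_sum diff_is_0_eq le_antisym order_refl)
    also have "\<dots> \<longleftrightarrow> (\<forall>P\<in>\<P>. g P \<le> 1)"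
      using fin by simp
    finally show ?thesis .
  qed
  also have "\<dots> \<longleftrightarrow> (\<forall>u v. u \<noteq> v \<longrightarrow> gpn_between G u v \<le> 1)"
  proof
    assume *: "\<forall>P\<in>\<P>. g P \<le> 1"
    show "\<forall>u v. u \<noteq> v \<longrightarrow> gpn_between G u v \<le> 1"
    proof (intro allI impI)
      fix u v :: 'a assume "u \<noteq> v"
      show "gpn_between G u v \<le> 1"
      proof (cases "u \<in> pverts G \<and> v \<in> pverts G")
        case True
        then have "{u, v} \<in> \<P>" using \<open>u \<noteq> v\<close> by (simp add: \<P>_def)
        then show ?thesis using * g by metis
      qed (simp add: gpn_between_eq_0)
    qed
  qed (auto simp: \<P>_def card_2_iff g)
  also have "\<dots> \<longleftrightarrow> (\<forall>p. is_cycle G p \<longrightarrow> odd (length p))"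
    by (rule all_gpn_between_le_1_iff[OF disj])
  finally show ?thesis
    using gpn ge choose_2_add_self[of n] by (metis add_le_cancel_right add_right_cancel)
qed

end
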